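(* Let $Q,R,S\in\mathfrak{P}$ with $Q\cap R=\emptyset$, $Q\cap S=\emptyset$; let $Y$ be the carrier of $Q$ and $X$ the carrier of $R$. Let $\epsilon:\mathcal{E}(Q\oplus R)\to\mathcal{E}(Q\oplus S)$ be an injective homomorphism (with respect to $\le_+$) such that for every $P\in\mathfrak{P}_r$, $\xi\in\mathcal{H}(P,Q\oplus R)$ and $x\in P$ we have $\alpha_{P,\eta(\xi)}(x)=\epsilon(\alpha_{P,\xi}(x))$, where $\eta(\xi):P\to Q\oplus S$ is defined by $\eta(\xi)(z):=\epsilon(\alpha_{P,\xi}(z))_1$. Put $\mathcal{E}(Q)^*:=\{(y,D,U\cup X):(y,D,U)\in\mathcal{E}(Q)\}\subseteq\mathcal{E}(Q\oplus R)$, and define $r:\mathcal{E}(R)\to\mathcal{E}(Q\oplus R)$, $r(x,D,U):=(x,D\cup Y,U)$, and $s(x,D,U):=(x,D\setminus Y,U)$ for $(x,D,U)\in\mathcal{E}(Q\oplus S)$. Assume $Y\subseteq\{\epsilon(\mathfrak a)_1:\mathfrak a\in\mathcal{E}(Q)^*\}$. Then $R\sqsubseteq_I S$. More precisely, $T:=s\circ\epsilon\circ r$ is an injective homomorphism $\mathcal{E}(R)\to\mathcal{E}(S)$, and for all $P\in\mathfrak{P}_r$, $\xi\in\mathcal{H}(P,R)$, $x\in P$ we have $\alpha_{P,\tau_P(\xi)}(x)=T(\alpha_{P,\xi}(x))$, where $\tau_P(\xi)(z):=T(\alpha_{P,\xi}(z))_1$ for $z\in P$.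
   Context: $\mathfrak{P}$ is the class of finite nonempty posets and $\mathfrak{P}_r$ a fixed system of representatives of its isomorphism classes. $\mathcal{H}(P,Q)$ is the set of order-preserving maps $P\to Q$. $A\oplus B$ is the ordinal sum of disjoint posets (every element of $A$ below every element of $B$). For $A\subseteq P$, $x\in A$: $\gamma_A(x)$ is the set of $y\in A$ joined to $x$ by a sequence $x=z_0,\dots,z_L=y$ in $A$ ($L\ge0$) with consecutive elements strictly comparable; for a map $\xi$ on $P$, $G_\xi(x):=\gamma_{\xi^{-1}(\xi(x))}(x)$. For $A\subseteq P$, ${\downarrow^{\circ}}A:=\{y: y\le a\text{ for some }a\in A\}\setminus A$, ${\uparrow_{\circ}}A:=\{y: y\ge a\text{ for some }a\in A\}\setminus A$. The EV-system $\mathcal{E}(P)$ is the set of triples $(x,D,U)$ with $x\in P$, $D\subseteq{\downarrow^{\circ}}\{x\}$, $U\subseteq{\uparrow_{\circ}}\{x\}$; $\mathfrak a<_+\mathfrak b$ iff $\mathfrak a_1\in\mathfrak b_2$ and $\mathfrak b_1\in\mathfrak a_3$; $\le_+$ is $<_+$ plus equality; a homomorphism $f$ between EV-systems satisfies $\mathfrak a\le_+\mathfrak b\Rightarrow f(\mathfrak a)\le_+ f(\mathfrak b)$. For $\xi\in\mathcal{H}(P,Q)$, $\alpha_{P,\xi}(x):=(\xi(x),\xi({\downarrow^{\circ}}G_\xi(x)),\xi({\uparrow_{\circ}}G_\xi(x)))$. A Hom-scheme from $R$ to $S$ is a family $(\rho_P)_{P\in\mathfrak{P}_r}$ of maps $\rho_P:\mathcal{H}(P,R)\to\mathcal{H}(P,S)$;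 strong if each $\rho_P$ is injective; an I-scheme if for all $P,P'\in\mathfrak{P}_r$, $\xi\in\mathcal{H}(P,R)$, $\zeta\in\mathcal{H}(P',R)$, $x\in P$, $y\in P'$: $\alpha_{P,\xi}(x)\le_+\alpha_{P',\zeta}(y)$ implies $\alpha_{P,\rho_P(\xi)}(x)\le_+\alpha_{P',\rho_{P'}(\zeta)}(y)$, with $<_+$ preserved. $R\sqsubseteq_I S$ means a strong I-scheme from $R$ to $S$ exists. *)

theory Defs
  imports Main "HOL-Library.FuncSet"
begin

(* A poset is given by its reflexive order relation P; its carrier is Field P and
   "x \<le> y in P" is "(x, y) \<in> P". *)

definition fin_poset :: "'a rel \<Rightarrow> bool" where
  "fin_poset P \<longleftrightarrow> Partial_order P \<and> finite (Field P) \<and> Field P \<noteq> {}"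

definition poset_iso :: "'a rel \<Rightarrow> 'b rel \<Rightarrow> bool" where
  "poset_iso P Q \<longleftrightarrow> (\<exists>f. bij_betw f (Field P) (Field Q) \<and>
     (\<forall>x\<in>Field P. \<forall>y\<in>Field P. (x, y) \<in> P \<longleftrightarrow> (f x, f y) \<in> Q))"

(* Every finite poset, over whatever type, is isomorphic to one on natural numbers, so
   quantifying over posets on nat covers all isomorphism classes. *)
definition rep_system :: "'p rel set \<Rightarrow> bool" where
  "rep_system Pr \<longleftrightarrow> (\<forall>P\<in>Pr. fin_poset P) \<and>
     (\<forall>N :: nat rel. fin_poset N \<longrightarrow> (\<exists>!P. P \<in> Pr \<and> poset_iso N P))"

(* Maps are extensional (undefined outside the carrier), so that equality in Hom P Q is
   equality of maps on the carrier of P. *)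
definition Hom :: "'p rel \<Rightarrow> 'a rel \<Rightarrow> ('p \<Rightarrow> 'a) set" where
  "Hom P Q = {f \<in> Field P \<rightarrow>\<^sub>E Field Q. \<forall>x y. (x, y) \<in> P \<longrightarrow> (f x, f y) \<in> Q}"

(* Meaningful for disjoint carriers. *)
definition ord_sum :: "'a rel \<Rightarrow> 'a rel \<Rightarrow> 'a rel" (infixr "\<oplus>" 65) where
  "A \<oplus> B = A \<union> B \<union> Field A \<times> Field B"

definition comp_edges :: "'a rel \<Rightarrow> 'a set \<Rightarrow> 'a rel" where
  "comp_edges P A = {(u, v). u \<in> A \<and> v \<in> A \<and> u \<noteq> v \<and> ((u, v) \<in> P \<or> (v, u) \<in> P)}"

definition conn_comp :: "'a rel \<Rightarrow> 'a set \<Rightarrow> 'a \<Rightarrow> 'a set" where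
  "conn_comp P A x = {y. (x, y) \<in> (comp_edges P A)\<^sup>*}"

definition fibre_comp :: "'p rel \<Rightarrow> ('p \<Rightarrow> 'a) \<Rightarrow> 'p \<Rightarrow> 'p set" where
  "fibre_comp P \<xi> x = conn_comp P {z \<in> Field P. \<xi> z = \<xi> x} x"

definition down_open :: "'a rel \<Rightarrow> 'a set \<Rightarrow> 'a set" where
  "down_open P A = {y. \<exists>a\<in>A. (y, a) \<in> P} - A"

definition up_open :: "'a rel \<Rightarrow> 'a set \<Rightarrow> 'a set" where
  "up_open P A = {y. \<exists>a\<in>A. (a, y) \<in> P} - A"

type_synonym 'a ev = "'a \<times> 'a set \<times> 'a set"

definition EV :: "'a rel \<Rightarrow> 'a ev set" where
  "EV P = {(x, D, U). x \<in> Field P \<and> D \<subseteq> down_open P {x} \<and> U \<subseteq> up_open P {x}}"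

definition ev_less :: "'a ev \<Rightarrow> 'a ev \<Rightarrow> bool" where
  "ev_less a b \<longleftrightarrow> fst a \<in> fst (snd b) \<and> fst b \<in> snd (snd a)"

definition ev_le :: "'a ev \<Rightarrow> 'a ev \<Rightarrow> bool" where
  "ev_le a b \<longleftrightarrow> ev_less a b \<or> a = b"

definition ev_hom :: "'a rel \<Rightarrow> 'b rel \<Rightarrow> ('a ev \<Rightarrow> 'b ev) \<Rightarrow> bool" where
  "ev_hom P Q f \<longleftrightarrow> f \<in> EV P \<rightarrow> EV Q \<and>
     (\<forall>a\<in>EV P. \<forall>b\<in>EV P. ev_le a b \<longrightarrow> ev_le (f a) (f b))"

definition alpha :: "'p rel \<Rightarrow> ('p \<Rightarrow> 'a) \<Rightarrow> 'p \<Rightarrow> 'a ev" where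
  "alpha P \<xi> x =
     (\<xi> x, \<xi> ` down_open P (fibre_comp P \<xi> x), \<xi> ` up_open P (fibre_comp P \<xi> x))"

definition Hom_scheme ::
  "'p rel set \<Rightarrow> 'a rel \<Rightarrow> 'b rel \<Rightarrow> ('p rel \<Rightarrow> ('p \<Rightarrow> 'a) \<Rightarrow> ('p \<Rightarrow> 'b)) \<Rightarrow> bool" where
  "Hom_scheme Pr R S \<rho> \<longleftrightarrow> (\<forall>P\<in>Pr. \<rho> P \<in> Hom P R \<rightarrow> Hom P S)"

definition strong_scheme ::
  "'p rel set \<Rightarrow> 'a rel \<Rightarrow> ('p rel \<Rightarrow> ('p \<Rightarrow> 'a) \<Rightarrow> ('p \<Rightarrow> 'b)) \<Rightarrow> bool" where
  "strong_scheme Pr R \<rho> \<longleftrightarrow> (\<forall>P\<in>Pr. inj_on (\<rho> P) (Hom P R))"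

definition I_scheme ::
  "'p rel set \<Rightarrow> 'a rel \<Rightarrow> 'b rel \<Rightarrow> ('p rel \<Rightarrow> ('p \<Rightarrow> 'a) \<Rightarrow> ('p \<Rightarrow> 'b)) \<Rightarrow> bool" where
  "I_scheme Pr R S \<rho> \<longleftrightarrow> Hom_scheme Pr R S \<rho> \<and>
     (\<forall>P\<in>Pr. \<forall>P'\<in>Pr. \<forall>\<xi>\<in>Hom P R. \<forall>\<zeta>\<in>Hom P' R. \<forall>x\<in>Field P. \<forall>y\<in>Field P'.
        (ev_le (alpha P \<xi> x) (alpha P' \<zeta> y) \<longrightarrow>
           ev_le (alpha P (\<rho> P \<xi>) x) (alpha P' (\<rho> P' \<zeta>) y)) \<and>
        (ev_less (alpha P \<xi> x) (alpha P' \<zeta> y) \<longrightarrow>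
           ev_less (alpha P (\<rho> P \<xi>) x) (alpha P' (\<rho> P' \<zeta>) y)))"

definition I_below :: "'p rel set \<Rightarrow> 'a rel \<Rightarrow> 'b rel \<Rightarrow> bool" where
  "I_below Pr R S \<longleftrightarrow> (\<exists>\<rho>. I_scheme Pr R S \<rho> \<and> strong_scheme Pr R \<rho>)"

definition induced_map :: "'p rel \<Rightarrow> ('a ev \<Rightarrow> 'b ev) \<Rightarrow> ('p \<Rightarrow> 'a) \<Rightarrow> ('p \<Rightarrow> 'b)" where
  "induced_map P f \<xi> = (\<lambda>z\<in>Field P. fst (f (alpha P \<xi> z)))"

definition EV_star :: "'a rel \<Rightarrow> 'a rel \<Rightarrow> 'a ev set" where
  "EV_star Q R = {(y, D, U \<union> Field R) | y D U. (y, D, U) \<in> EV Q}"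

definition ev_lift :: "'a rel \<Rightarrow> 'a ev \<Rightarrow> 'a ev" where
  "ev_lift Q = (\<lambda>(x, D, U). (x, D \<union> Field Q, U))"

definition ev_drop :: "'a rel \<Rightarrow> 'a ev \<Rightarrow> 'a ev" where
  "ev_drop Q = (\<lambda>(x, D, U). (x, D - Field Q, U))"

end

theory Submission
  imports Defs
begin

text \<open>
  Every element of \<open>EV_star Q R\<close> lies strictly below every lifted element \<open>r(a)\<close>. As \<open>\<epsilon>\<close> is an
  injective homomorphism, the first components of \<open>\<epsilon>(EV_star Q R)\<close> belong to the lower set of
  \<open>\<epsilon>(r(a))\<close>, so this lower set contains all of \<open>Y\<close>, and the first component of \<open>\<epsilon>(r(a))\<close> is in \<open>S\<close>.
  Hence \<open>T\<close> is an injective homomorphism.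

  For \<open>\<xi> \<in> Hom P R\<close>, let \<open>W\<close> be the representative of \<open>Q \<oplus> P\<close> and \<open>\<xi>' = id\<^sub>Q \<union> \<xi>\<close> on \<open>W\<close>. On \<open>P\<close>
  we have \<open>\<alpha>(\<xi>') = r(\<alpha>(\<xi>))\<close>, so there \<open>\<eta>(\<xi>')\<close> agrees with \<open>\<tau>(\<xi>)\<close>, and its values are in \<open>S\<close>. The
  lower set of \<open>\<alpha>(\<eta>(\<xi>')) = \<epsilon>(r(\<alpha>(\<xi>)))\<close> contains \<open>Y\<close>, and its members in \<open>Y\<close> can only be images of
  points of \<open>Q\<close>; by counting, \<open>\<eta>(\<xi>')\<close> maps \<open>Q\<close> onto \<open>Y\<close>. Thus \<open>\<alpha>(\<eta>(\<xi>')) = r(\<alpha>(\<tau>(\<xi>)))\<close> on \<open>P\<close>, and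
  removing \<open>Y\<close> gives the claim.
\<close>

section \<open>Isomorphic copies of finite posets, and ordinal sums among the
  representatives\<close>

lemma fin_poset_dir_image:
  assumes P: "fin_poset P" and f: "inj_on f (Field P)"
  shows "fin_poset (dir_image P f)" and "poset_iso P (dir_image P f)"
proof -
  have "(f x, f y) \<in> dir_image P f \<longleftrightarrow> (x, y) \<in> P" if "x \<in> Field P" "y \<in> Field P" for x y
  proof
    assume "(f x, f y) \<in> dir_image P f"
    then obtain a b where ab: "(a, b) \<in> P" "f x = f a" "f y = f b"
      unfolding dir_image_def by blast
    then have "a \<in> Field P" "b \<in> Field P" by (auto dest: FieldI1 FieldI2)
    with ab that f show "(x, y) \<in> P" by (metis inj_onD)
  qed (auto simp: dir_image_def)
  then show "poset_iso P (dir_image P f)"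
    using f unfolding poset_iso_def bij_betw_def by (intro exI[of _ f]) (auto simp: dir_image_Field)
  have "Partial_order P" using P by (simp add: fin_poset_def)
  then have "Partial_order (dir_image P f)" using f by (rule Partial_order_dir_image)
  then show "fin_poset (dir_image P f)"
    using P by (simp add: fin_poset_def dir_image_Field)
qed

lemma poset_iso_trans:
  assumes "poset_iso P Q" "poset_iso Q R"
  shows "poset_iso P R"
proof -
  obtain f g where f: "bij_betw f (Field P) (Field Q)"
    "\<forall>x\<in>Field P. \<forall>y\<in>Field P. (x, y) \<in> P \<longleftrightarrow> (f x, f y) \<in> Q"
    and g: "bij_betw g (Field Q) (Field R)"
    "\<forall>x\<in>Field Q. \<forall>y\<in>Field Q. (x, y) \<in> Q \<longleftrightarrow> (g x, g y) \<in> R"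
    using assms unfolding poset_iso_def by blast
  have "f x \<in> Field Q" if "x \<in> Field P" for x
    using that f(1) by (auto simp: bij_betw_def)
  then show ?thesis
    using f g bij_betw_trans[OF f(1) g(1)] unfolding poset_iso_def
    by (intro exI[of _ "g \<circ> f"]) auto
qed

text \<open>\<open>rep_system\<close> only speaks of posets on \<open>nat\<close>, so the finite
  carrier is first relabelled by natural numbers.\<close>

lemma rep_system_representative:
  assumes "rep_system Pr" and M: "fin_poset M"
  obtains P where "P \<in> Pr" "poset_iso M P"
proof -
  have "finite (Field M)" using M by (simp add: fin_poset_def)
  then obtain f :: "_ \<Rightarrow> nat" where "inj_on f (Field M)"
    using finite_imp_inj_to_nat_seg by metis
  from fin_poset_dir_image[OF M this] assms(1) show ?thesis
    unfolding rep_system_def by (meson poset_iso_trans that)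
qed

text \<open>\<open>W\<close> is the ordinal sum \<open>Q \<oplus> P\<close> up to isomorphism, embedded by \<open>i\<close> and \<open>j\<close>. The detour is needed because
  \<open>Q\<close> and \<open>P\<close> live over different types and the assumption on \<open>\<epsilon>\<close> only speaks about members of \<open>Pr\<close>.\<close>

locale ord_sum_copy =
  fixes Q :: "'q rel" and P :: "'p rel" and W :: "'w rel" and i :: "'q \<Rightarrow> 'w" and j :: "'p \<Rightarrow> 'w"
  assumes Field_copy: "Field W = i ` Field Q \<union> j ` Field P"
    and inj_i: "inj_on i (Field Q)"
    and inj_j: "inj_on j (Field P)"
    and disjoint: "i ` Field Q \<inter> j ` Field P = {}"
    and ii: "\<lbrakk>a \<in> Field Q; b \<in> Field Q\<rbrakk> \<Longrightarrow> (i a, i b) \<in> W \<longleftrightarrow> (a, b) \<in> Q"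
    and jj: "\<lbrakk>x \<in> Field P; y \<in> Field P\<rbrakk> \<Longrightarrow> (j x, j y) \<in> W \<longleftrightarrow> (x, y) \<in> P"
    and ij: "\<lbrakk>a \<in> Field Q; x \<in> Field P\<rbrakk> \<Longrightarrow> (i a, j x) \<in> W"
    and ji: "\<lbrakk>a \<in> Field Q; x \<in> Field P\<rbrakk> \<Longrightarrow> (j x, i a) \<notin> W"

lemma Field_ord_sum: "Field (A \<oplus> B) = Field A \<union> Field B"
  unfolding ord_sum_def Field_def by auto

lemma fin_poset_ord_sum:
  assumes A: "fin_poset A" and B: "fin_poset B" and AB: "Field A \<inter> Field B = {}"
  shows "fin_poset (A \<oplus> B)"
proof -
  have "Refl (A \<oplus> B)"
    using A B unfolding fin_poset_def order_on_defs refl_on_def Field_ord_sum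
    by (auto simp: ord_sum_def intro: FieldI1 FieldI2)
  moreover have "trans (A \<oplus> B)"
  proof (rule transI)
    fix x y z assume "(x, y) \<in> A \<oplus> B" "(y, z) \<in> A \<oplus> B"
    moreover have "trans A" "trans B" using A B by (auto simp: fin_poset_def order_on_defs)
    ultimately show "(x, z) \<in> A \<oplus> B"
      using AB unfolding ord_sum_def by (auto dest: transD FieldI1 FieldI2)
  qed
  moreover have "antisym (A \<oplus> B)"
  proof (rule antisymI)
    fix x y assume "(x, y) \<in> A \<oplus> B" "(y, x) \<in> A \<oplus> B"
    moreover have "antisym A" "antisym B" using A B by (auto simp: fin_poset_def order_on_defs)
    ultimately show "x = y"
      using AB unfolding ord_sum_def by (auto dest: antisymD FieldI1 FieldI2)
  qed
  moreover have "A \<oplus> B \<subseteq> Field (A \<oplus> B) \<times> Field (A \<oplus> B)"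
    by (auto intro: FieldI1 FieldI2)
  moreover have "finite (Field (A \<oplus> B))" "Field (A \<oplus> B) \<noteq> {}"
    using A B by (auto simp: fin_poset_def Field_ord_sum)
  ultimately show ?thesis by (simp add: fin_poset_def order_on_defs)
qed

text \<open>Tagging with \<open>Inl\<close> and \<open>Inr\<close> puts both posets into one type
  with disjoint carriers; the embeddings are the tags followed by the isomorphism onto the
  representative.\<close>

lemma rep_system_ord_sum_copy:
  fixes Q :: "'q rel" and P :: "'p rel"
  assumes Pr: "rep_system Pr" and Q: "fin_poset Q" and P: "fin_poset P"
  obtains W i j where "W \<in> Pr" "ord_sum_copy Q P W i j"
proof -
  let ?Q = "dir_image Q Inl :: ('q + 'p) rel" and ?P = "dir_image P Inr :: ('q + 'p) rel"
  let ?M = "?Q \<oplus> ?P"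
  have F: "Field ?M = Inl ` Field Q \<union> Inr ` Field P"
    by (simp add: Field_ord_sum dir_image_Field)
  have "fin_poset ?M"
    by (intro fin_poset_ord_sum fin_poset_dir_image Q P) (auto simp: dir_image_Field)
  then obtain W where W: "W \<in> Pr" "poset_iso ?M W"
    using rep_system_representative[OF Pr] by blast
  then obtain f where f: "bij_betw f (Field ?M) (Field W)"
    and fW: "\<And>u v. \<lbrakk>u \<in> Field ?M; v \<in> Field ?M\<rbrakk> \<Longrightarrow> (f u, f v) \<in> W \<longleftrightarrow> (u, v) \<in> ?M"
    unfolding poset_iso_def by blast
  have inj: "inj_on f (Inl ` Field Q \<union> Inr ` Field P)"
    using f F by (simp add: bij_betw_def)
  have "ord_sum_copy Q P W (f \<circ> Inl) (f \<circ> Inr)"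
  proof
    show "Field W = (f \<circ> Inl) ` Field Q \<union> (f \<circ> Inr) ` Field P"
      using f F by (auto simp: bij_betw_def)
    show "inj_on (f \<circ> Inl) (Field Q)" "inj_on (f \<circ> Inr) (Field P)"
      "(f \<circ> Inl) ` Field Q \<inter> (f \<circ> Inr) ` Field P = {}"
      using inj by (auto simp: inj_on_def)
  qed (auto simp: fW F, auto simp: ord_sum_def dir_image_Field, auto simp: dir_image_def)
  with W that show ?thesis by blast
qed

section \<open>Fibre components and the triples \<open>alpha\<close>\<close>

lemma fibre_comp_refl: "x \<in> fibre_comp P \<xi> x"
  by (simp add: fibre_comp_def conn_comp_def)

lemma conn_comp_subset: "x \<in> A \<Longrightarrow> conn_comp P A x \<subseteq> A"
proof
  fix y assume "x \<in> A" "y \<in> conn_comp P A x"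
  then show "y \<in> A"
    unfolding conn_comp_def mem_Collect_eq by (auto elim: rtranclE simp: comp_edges_def)
qed

lemma fibre_comp_subset: "x \<in> Field P \<Longrightarrow> fibre_comp P \<xi> x \<subseteq> {z \<in> Field P. \<xi> z = \<xi> x}"
  unfolding fibre_comp_def by (rule conn_comp_subset) simp

lemma fibre_comp_step:
  assumes "x \<in> Field P" "a \<in> fibre_comp P \<xi> x" "(a, z) \<in> P \<or> (z, a) \<in> P" "\<xi> z = \<xi> x"
  shows "z \<in> fibre_comp P \<xi> x"
proof (cases "z = a")
  case False
  have "a \<in> Field P" "\<xi> a = \<xi> x" "z \<in> Field P"
    using fibre_comp_subset[OF assms(1)] assms by (auto dest: FieldI1 FieldI2)
  with False assms have "(a, z) \<in> comp_edges P {z \<in> Field P. \<xi> z = \<xi> x}"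
    by (auto simp: comp_edges_def)
  with assms(2) show ?thesis
    by (auto simp: fibre_comp_def conn_comp_def intro: rtrancl_into_rtrancl)
qed (use assms in auto)

lemma fibre_comp_eq:
  assumes "(x, y) \<in> P" "\<xi> x = \<xi> y"
  shows "fibre_comp P \<xi> x = fibre_comp P \<xi> y"
proof -
  let ?E = "comp_edges P {z \<in> Field P. \<xi> z = \<xi> y}"
  have "(x, y) \<in> ?E\<^sup>*" "(y, x) \<in> ?E\<^sup>*"
    using assms by (cases "x = y"; auto simp: comp_edges_def dest: FieldI1 FieldI2 intro!: r_into_rtrancl)+
  then show ?thesis
    unfolding fibre_comp_def conn_comp_def assms(2) by (auto intro: rtrancl_trans)
qed

text \<open>A point outside the component but comparable to one of its members cannot have the value
  \<open>\<xi> x\<close>, by \<open>fibre_comp_step\<close>; so monotonicity makes the comparison of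
  values strict.\<close>

lemma alpha_in_EV:
  assumes xi: "\<xi> \<in> Hom P R" and x: "x \<in> Field P"
  shows "alpha P \<xi> x \<in> EV R"
proof -
  have mono: "(\<xi> u, \<xi> v) \<in> R" if "(u, v) \<in> P" for u v
    using xi that by (auto simp: Hom_def)
  have fib: "\<xi> a = \<xi> x" if "a \<in> fibre_comp P \<xi> x" for a
    using fibre_comp_subset[OF x] that by blast
  have "\<xi> ` down_open P (fibre_comp P \<xi> x) \<subseteq> down_open R {\<xi> x}"
    using mono fib fibre_comp_step[OF x] unfolding down_open_def by fastforce
  moreover have "\<xi> ` up_open P (fibre_comp P \<xi> x) \<subseteq> up_open R {\<xi> x}"
    using mono fib fibre_comp_step[OF x] unfolding up_open_def by fastforce
  moreover have "\<xi> x \<in> Field R" using xi x by (auto simp: Hom_def)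
  ultimately show ?thesis unfolding alpha_def EV_def by simp
qed

text \<open>Points with equal values share their component and hence their triple. Otherwise each
  point lies in the open set of the other's component, which gives \<open>ev_less\<close>.\<close>

lemma alpha_mono:
  assumes xy: "(x, y) \<in> P"
  shows "ev_le (alpha P \<xi> x) (alpha P \<xi> y)"
proof (cases "\<xi> x = \<xi> y")
  case True
  then show ?thesis using fibre_comp_eq[of x y P \<xi>] xy by (simp add: alpha_def ev_le_def)
next
  case False
  have F: "x \<in> Field P" "y \<in> Field P" using xy by (auto dest: FieldI1 FieldI2)
  have "x \<in> down_open P (fibre_comp P \<xi> y)" "y \<in> up_open P (fibre_comp P \<xi> x)"
  proof -
    have "x \<notin> fibre_comp P \<xi> y" "y \<notin> fibre_comp P \<xi> x"
      using False fibre_comp_subset[OF F(1), of \<xi>] fibre_comp_subset[OF F(2), of \<xi>] by auto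
    then show "x \<in> down_open P (fibre_comp P \<xi> y)" "y \<in> up_open P (fibre_comp P \<xi> x)"
      using xy fibre_comp_refl[of x P \<xi>] fibre_comp_refl[of y P \<xi>]
      unfolding down_open_def up_open_def by blast+
  qed
  then show ?thesis by (simp add: ev_le_def ev_less_def alpha_def)
qed

section \<open>Schemes induced by homomorphisms of EV-systems\<close>

lemma ev_less_irrefl: "a \<in> EV P \<Longrightarrow> \<not> ev_less a a"
  by (auto simp: EV_def ev_less_def down_open_def)

lemma ev_le_fst:
  assumes "ev_le a b" "a \<in> EV P" "b \<in> EV P" "Refl P"
  shows "(fst a, fst b) \<in> P"
  using assms by (auto simp: EV_def ev_le_def ev_less_def down_open_def refl_on_def)

text \<open>Related triples are distinct by irreflexivity, and injectivity then excludes the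
  equality case of \<open>ev_le\<close> for the images.\<close>

lemma ev_hom_less:
  assumes "ev_hom P Q f" "inj_on f (EV P)" "a \<in> EV P" "b \<in> EV P" "ev_less a b"
  shows "ev_less (f a) (f b)"
proof -
  have "a \<noteq> b" using assms ev_less_irrefl by blast
  with assms show ?thesis unfolding ev_hom_def ev_le_def by (metis inj_onD)
qed

lemma induced_map_in_Hom:
  assumes T: "ev_hom R S T" and "Refl S" and xi: "\<xi> \<in> Hom P R"
  shows "induced_map P T \<xi> \<in> Hom P S"
proof -
  have TE: "T (alpha P \<xi> x) \<in> EV S" if "x \<in> Field P" for x
    using T alpha_in_EV[OF xi that] by (auto simp: ev_hom_def)
  have "(induced_map P T \<xi> x, induced_map P T \<xi> y) \<in> S" if "(x, y) \<in> P" for x y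
  proof -
    have F: "x \<in> Field P" "y \<in> Field P" using that by (auto dest: FieldI1 FieldI2)
    then have "ev_le (T (alpha P \<xi> x)) (T (alpha P \<xi> y))"
      using T alpha_mono[OF that] alpha_in_EV[OF xi] unfolding ev_hom_def by blast
    then show ?thesis using F TE ev_le_fst \<open>Refl S\<close> by (fastforce simp: induced_map_def)
  qed
  moreover have "induced_map P T \<xi> \<in> Field P \<rightarrow>\<^sub>E Field S"
    using TE by (fastforce simp: induced_map_def EV_def)
  ultimately show ?thesis by (auto simp: Hom_def)
qed

text \<open>The identity \<open>al\<close> turns both order conditions into properties of
  \<open>T\<close>. It also makes the scheme strong: \<open>T\<close> can be cancelled, and the
  first component of \<open>alpha P \<xi> x\<close> is \<open>\<xi> x\<close>.\<close>

lemma I_below_induced: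
  assumes T: "ev_hom R S T" and inj: "inj_on T (EV R)"
    and hom: "\<And>P \<xi>. \<lbrakk>P \<in> Pr; \<xi> \<in> Hom P R\<rbrakk> \<Longrightarrow> induced_map P T \<xi> \<in> Hom P S"
    and al: "\<And>P \<xi> x. \<lbrakk>P \<in> Pr; \<xi> \<in> Hom P R; x \<in> Field P\<rbrakk>
      \<Longrightarrow> alpha P (induced_map P T \<xi>) x = T (alpha P \<xi> x)"
  shows "I_below Pr R S"
proof -
  have "I_scheme Pr R S (\<lambda>P. induced_map P T)"
    unfolding I_scheme_def Hom_scheme_def
  proof (intro conjI ballI impI funcsetI)
    fix P P' \<xi> \<zeta> x y
    assume h: "P \<in> Pr" "P' \<in> Pr" "\<xi> \<in> Hom P R" "\<zeta> \<in> Hom P' R" "x \<in> Field P" "y \<in> Field P'"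
    note E = alpha_in_EV[OF h(3,5)] alpha_in_EV[OF h(4,6)]
    show "ev_le (alpha P (induced_map P T \<xi>) x) (alpha P' (induced_map P' T \<zeta>) y)"
      if "ev_le (alpha P \<xi> x) (alpha P' \<zeta> y)"
      using that h al T E by (simp add: ev_hom_def)
    show "ev_less (alpha P (induced_map P T \<xi>) x) (alpha P' (induced_map P' T \<zeta>) y)"
      if "ev_less (alpha P \<xi> x) (alpha P' \<zeta> y)"
      using that h al ev_hom_less[OF T inj E] by simp
  qed (rule hom)
  moreover have "inj_on (induced_map P T) (Hom P R)" if "P \<in> Pr" for P
  proof (rule inj_onI)
    fix \<xi> \<zeta> assume h: "\<xi> \<in> Hom P R" "\<zeta> \<in> Hom P R" "induced_map P T \<xi> = induced_map P T \<zeta>"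
    have "\<xi> x = \<zeta> x" if x: "x \<in> Field P" for x
    proof -
      have "T (alpha P \<xi> x) = T (alpha P \<zeta> x)"
        using al[OF \<open>P \<in> Pr\<close> _ x] h by metis
      then have "alpha P \<xi> x = alpha P \<zeta> x"
        using inj alpha_in_EV x h by (metis inj_onD)
      then show ?thesis by (simp add: alpha_def)
    qed
    with h show "\<xi> = \<zeta>" unfolding Hom_def by (auto intro: PiE_ext)
  qed
  ultimately show ?thesis unfolding I_below_def strong_scheme_def by blast
qed

section \<open>The triples \<open>alpha\<close> on a copy of an ordinal sum\<close>

context ord_sum_copy
begin

lemma comp_edges_copy:
  assumes "A \<subseteq> Field P"
  shows "comp_edges W (j ` A) = map_prod j j ` comp_edges P A"
  using assms jj inj_j unfolding comp_edges_def
  by (auto simp: subset_iff image_iff inj_on_def)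

lemma conn_comp_copy:
  assumes A: "A \<subseteq> Field P" and x: "x \<in> A"
  shows "conn_comp W (j ` A) (j x) = j ` conn_comp P A x"
proof -
  have "\<exists>y. v = j y \<and> (x, y) \<in> (comp_edges P A)\<^sup>*" if "(j x, v) \<in> (comp_edges W (j ` A))\<^sup>*" for v
    using that
  proof (induction rule: rtrancl_induct)
    case (step v w)
    then obtain y where y: "v = j y" "(x, y) \<in> (comp_edges P A)\<^sup>*" by blast
    from step obtain y' z where z: "v = j y'" "w = j z" "(y', z) \<in> comp_edges P A"
      unfolding comp_edges_copy[OF A] by auto
    \<comment> \<open>The path so far and the new edge give two preimages of \<open>v\<close>, which
      injectivity of \<open>j\<close> on \<open>A\<close> identifies.\<close>
    have "y \<in> A" using conn_comp_subset[OF x] y by (auto simp: conn_comp_def)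
    moreover have "y' \<in> A" using z by (auto simp: comp_edges_def)
    ultimately have "y = y'" using y z A inj_j by (auto dest: inj_onD)
    with y z show ?case by (blast intro: rtrancl_into_rtrancl)
  qed auto
  moreover have "(j x, j y) \<in> (comp_edges W (j ` A))\<^sup>*" if "(x, y) \<in> (comp_edges P A)\<^sup>*" for y
    using that
  proof (induction rule: rtrancl_induct)
    case (step y z)
    then have "(j y, j z) \<in> comp_edges W (j ` A)"
      unfolding comp_edges_copy[OF A] by force
    with step show ?case by (blast intro: rtrancl_into_rtrancl)
  qed auto
  ultimately show ?thesis unfolding conn_comp_def by blast
qed

text \<open>By \<open>dis\<close>, the fibre through \<open>j x\<close> contains no point of the
  copy of \<open>Q\<close>, so it is the image of a fibre in \<open>P\<close>.\<close>

lemma fibre_comp_copy: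
  assumes phi: "\<And>z. z \<in> Field P \<Longrightarrow> \<phi> (j z) = \<psi> z"
    and dis: "\<phi> ` i ` Field Q \<inter> \<psi> ` Field P = {}" and x: "x \<in> Field P"
  shows "fibre_comp W \<phi> (j x) = j ` fibre_comp P \<psi> x"
proof -
  have "{z \<in> Field W. \<phi> z = \<phi> (j x)} = j ` {z \<in> Field P. \<psi> z = \<psi> x}"
    using phi dis x unfolding Field_copy by (auto simp: disjoint_iff image_iff)
  then show ?thesis
    unfolding fibre_comp_def using x by (simp add: conn_comp_copy)
qed

lemma below_copy:
  assumes "x \<in> Field P"
  shows "{w. (w, j x) \<in> W} = i ` Field Q \<union> j ` {y. (y, x) \<in> P}"
proof -
  have "w \<in> i ` Field Q \<or> (\<exists>y\<in>Field P. w = j y)" if "(w, j x) \<in> W" for w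
    using that Field_copy by (auto dest: FieldI1)
  moreover have "y \<in> Field P" if "(y, x) \<in> P" for y using that by (rule FieldI1)
  ultimately show ?thesis using assms ij jj by auto blast
qed

lemma above_copy:
  assumes "x \<in> Field P"
  shows "{w. (j x, w) \<in> W} = j ` {y. (x, y) \<in> P}"
proof -
  have "\<exists>y\<in>Field P. w = j y" if "(j x, w) \<in> W" for w
    using FieldI2[OF that] that ji[OF _ assms] Field_copy by auto
  moreover have "y \<in> Field P" if "(x, y) \<in> P" for y using that by (rule FieldI2)
  ultimately show ?thesis using assms jj by auto blast
qed

lemma down_open_copy:
  assumes G: "G \<subseteq> Field P" "G \<noteq> {}"
  shows "down_open W (j ` G) = i ` Field Q \<union> j ` down_open P G"
proof -
  let ?D = "{y. \<exists>a\<in>G. (y, a) \<in> P}"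
  have "{w. \<exists>a\<in>j ` G. (w, a) \<in> W} = (\<Union>a\<in>G. {w. (w, j a) \<in> W})" by auto
  also have "\<dots> = (\<Union>a\<in>G. i ` Field Q \<union> j ` {y. (y, a) \<in> P})"
    by (intro SUP_cong refl below_copy) (use G in auto)
  \<comment> \<open>A single member of \<open>G\<close> already has the whole copy of
    \<open>Q\<close> below it; this is where \<open>G\<close> must be nonempty.\<close>
  also have "\<dots> = i ` Field Q \<union> j ` ?D" using G(2) by blast
  finally have "down_open W (j ` G) = (i ` Field Q \<union> j ` ?D) - j ` G" by (simp add: down_open_def)
  also have "\<dots> = i ` Field Q \<union> (j ` ?D - j ` G)" using G(1) disjoint by blast
  also have "j ` ?D - j ` G = j ` (?D - G)"
    by (rule inj_on_image_set_diff[OF inj_j, symmetric]) (use G(1) in \<open>auto dest: FieldI1\<close>)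
  finally show ?thesis by (simp add: down_open_def)
qed

lemma up_open_copy:
  assumes G: "G \<subseteq> Field P"
  shows "up_open W (j ` G) = j ` up_open P G"
proof -
  let ?U = "{y. \<exists>a\<in>G. (a, y) \<in> P}"
  have "{w. \<exists>a\<in>j ` G. (a, w) \<in> W} = (\<Union>a\<in>G. {w. (j a, w) \<in> W})" by auto
  also have "\<dots> = (\<Union>a\<in>G. j ` {y. (a, y) \<in> P})"
    by (intro SUP_cong refl above_copy) (use G in auto)
  also have "\<dots> = j ` ?U" by blast
  finally have "up_open W (j ` G) = j ` ?U - j ` G" by (simp add: up_open_def)
  also have "\<dots> = j ` (?U - G)"
    by (rule inj_on_image_set_diff[OF inj_j, symmetric]) (use G in \<open>auto dest: FieldI2\<close>)
  finally show ?thesis by (simp add: up_open_def)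
qed

text \<open>The copy of \<open>Q\<close> lies below every point of the copy of \<open>P\<close> and
  contributes exactly \<open>Field Y\<close> to the lower set; nothing is added above. In the main
  proof this is applied to the glued map and again to its image under the scheme of
  \<open>\<epsilon>\<close>.\<close>

lemma alpha_copy:
  assumes phi: "\<And>z. z \<in> Field P \<Longrightarrow> \<phi> (j z) = \<psi> z"
    and im: "\<phi> ` i ` Field Q = Field Y" and dis: "Field Y \<inter> \<psi> ` Field P = {}"
    and x: "x \<in> Field P"
  shows "alpha W \<phi> (j x) = ev_lift Y (alpha P \<psi> x)"
proof -
  let ?G = "fibre_comp P \<psi> x"
  have G: "?G \<subseteq> Field P" "?G \<noteq> {}"
    using fibre_comp_subset[OF x] fibre_comp_refl by fast+
  have "\<phi> ` j ` B = \<psi> ` B" if "B \<subseteq> Field P" for B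
    using that phi by (force simp: image_image intro!: image_cong)
  moreover have "down_open P ?G \<subseteq> Field P" "up_open P ?G \<subseteq> Field P"
    by (auto simp: down_open_def up_open_def dest: FieldI1 FieldI2)
  moreover have "fibre_comp W \<phi> (j x) = j ` ?G"
    using phi x im dis by (intro fibre_comp_copy) auto
  ultimately show ?thesis
    using im by (simp add: alpha_def ev_lift_def down_open_copy[OF G] up_open_copy[OF G(1)] image_Un phi[OF x] Un_commute)
qed

end

section \<open>Adding and removing the carrier of \<open>Q\<close> in lower sets\<close>

lemma ev_drop_lift:
  "fst (snd a) \<inter> Field Q = {} \<Longrightarrow> ev_drop Q (ev_lift Q a) = a"
  by (cases a) (auto simp: ev_drop_def ev_lift_def)

lemma fst_ev_drop [simp]: "fst (ev_drop Q a) = fst a"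
  by (cases a) (simp add: ev_drop_def)

lemma ev_lift_in_EV:
  assumes "a \<in> EV R" "Field Q \<inter> Field R = {}"
  shows "ev_lift Q a \<in> EV (Q \<oplus> R)"
  using assms unfolding EV_def ev_lift_def Field_ord_sum
  by (auto simp: down_open_def up_open_def ord_sum_def)

lemma EV_star_in_EV:
  assumes "b \<in> EV_star Q R" "Field Q \<inter> Field R = {}"
  shows "b \<in> EV (Q \<oplus> R)"
  using assms unfolding EV_def EV_star_def Field_ord_sum
  by (auto simp: down_open_def up_open_def ord_sum_def)

lemma EV_star_less_ev_lift:
  assumes "b \<in> EV_star Q R" "a \<in> EV R"
  shows "ev_less b (ev_lift Q a)"
  using assms by (auto simp: ev_less_def EV_star_def ev_lift_def EV_def)

lemma inj_on_ev_lift: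
  assumes "Field Q \<inter> Field R = {}"
  shows "inj_on (ev_lift Q) (EV R)"
proof (rule inj_on_inverseI[where g = "ev_drop Q"])
  fix a assume "a \<in> EV R"
  then have "fst (snd a) \<subseteq> Field R" by (auto simp: EV_def down_open_def dest: FieldI1)
  with assms show "ev_drop Q (ev_lift Q a) = a" by (intro ev_drop_lift) auto
qed

lemma ev_lift_le: "ev_le a b \<Longrightarrow> ev_le (ev_lift Q a) (ev_lift Q b)"
  by (auto simp: ev_le_def ev_less_def ev_lift_def split: prod.splits)

text \<open>Above a point of \<open>S\<close> the ordinal sum has only points of \<open>S\<close>;
  below it, the points outside \<open>S\<close> are those of \<open>Q\<close>, which are
  removed.\<close>

lemma ev_drop_in_EV:
  assumes "a \<in> EV (Q \<oplus> S)" "fst a \<in> Field S" "Field Q \<inter> Field S = {}"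
  shows "ev_drop Q a \<in> EV S"
  using assms unfolding EV_def ev_drop_def Field_ord_sum
  by (auto simp: down_open_def up_open_def ord_sum_def dest: FieldI1 FieldI2)

text \<open>Since \<open>fst a\<close> is outside \<open>Field Q\<close>, it survives the removal
  from the lower set of \<open>b\<close>.\<close>

lemma ev_drop_le: "\<lbrakk>ev_le a b; fst a \<notin> Field Q\<rbrakk> \<Longrightarrow> ev_le (ev_drop Q a) (ev_drop Q b)"
  by (auto simp: ev_le_def ev_less_def ev_drop_def split: prod.splits)

text \<open>A lower set containing \<open>Field Q\<close> is recovered by adding
  \<open>Field Q\<close> back.\<close>

lemma inj_on_ev_drop: "inj_on (ev_drop Q) {a. Field Q \<subseteq> fst (snd a)}"
  by (auto simp: inj_on_def ev_drop_def)

theorem theorem6: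
  fixes Pr :: "'p rel set"
    and Q R S :: "'a rel"
    and \<epsilon> :: "'a ev \<Rightarrow> 'a ev"
  assumes "rep_system Pr"
    and "fin_poset Q" and "fin_poset R" and "fin_poset S"
    and "Field Q \<inter> Field R = {}" and "Field Q \<inter> Field S = {}"
    and "ev_hom (Q \<oplus> R) (Q \<oplus> S) \<epsilon>" and "inj_on \<epsilon> (EV (Q \<oplus> R))"
    and "\<forall>P\<in>Pr. \<forall>\<xi>\<in>Hom P (Q \<oplus> R). \<forall>x\<in>Field P.
           alpha P (induced_map P \<epsilon> \<xi>) x = \<epsilon> (alpha P \<xi> x)"
    and "Field Q \<subseteq> (\<lambda>a. fst (\<epsilon> a)) ` EV_star Q R"
  shows "I_below Pr R S \<and>
    (let T = ev_drop Q \<circ> \<epsilon> \<circ> ev_lift Q in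
       ev_hom R S T \<and> inj_on T (EV R) \<and>
       (\<forall>P\<in>Pr. \<forall>\<xi>\<in>Hom P R.
          induced_map P T \<xi> \<in> Hom P S \<and>
          (\<forall>x\<in>Field P. alpha P (induced_map P T \<xi>) x = T (alpha P \<xi> x))))"
proof -
  define T where "T = ev_drop Q \<circ> \<epsilon> \<circ> ev_lift Q"
  note QR = assms(5) and QS = assms(6) and eps = assms(7) and inj = assms(8)
  have E: "\<epsilon> (ev_lift Q a) \<in> EV (Q \<oplus> S)" if "a \<in> EV R" for a
    using eps ev_lift_in_EV[OF that QR] by (auto simp: ev_hom_def)
  have Y: "Field Q \<subseteq> fst (snd (\<epsilon> (ev_lift Q a)))" if a: "a \<in> EV R" for a
  proof
    fix y assume "y \<in> Field Q"
    then obtain b where b: "b \<in> EV_star Q R" "fst (\<epsilon> b) = y" using assms(10) by blast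
    have "ev_less (\<epsilon> b) (\<epsilon> (ev_lift Q a))"
      using ev_hom_less[OF eps inj] EV_star_in_EV[OF b(1) QR] ev_lift_in_EV[OF a QR]
        EV_star_less_ev_lift[OF b(1) a] by blast
    with b show "y \<in> fst (snd (\<epsilon> (ev_lift Q a)))" by (simp add: ev_less_def)
  qed
  have X: "fst (\<epsilon> (ev_lift Q a)) \<in> Field S" if a: "a \<in> EV R" for a
  proof -
    \<comment> \<open>The lower set of a triple omits its own first component, which therefore
      cannot lie in \<open>Field Q\<close>.\<close>
    have "fst (\<epsilon> (ev_lift Q a)) \<notin> fst (snd (\<epsilon> (ev_lift Q a)))"
      "fst (\<epsilon> (ev_lift Q a)) \<in> Field Q \<union> Field S"
      using E[OF a] by (auto simp: EV_def down_open_def Field_ord_sum)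
    then show ?thesis using Y[OF a] by blast
  qed
  have T_hom: "ev_hom R S T"
  proof -
    have "ev_le (T a) (T b)" if "a \<in> EV R" "b \<in> EV R" "ev_le a b" for a b
    proof -
      have "ev_le (\<epsilon> (ev_lift Q a)) (\<epsilon> (ev_lift Q b))"
        using that eps ev_lift_le ev_lift_in_EV QR unfolding ev_hom_def by blast
      then show ?thesis unfolding T_def using X[OF that(1)] QS by (auto intro: ev_drop_le)
    qed
    moreover have "T a \<in> EV S" if "a \<in> EV R" for a
      unfolding T_def using ev_drop_in_EV[OF E X QS] that by simp
    ultimately show ?thesis by (auto simp: ev_hom_def)
  qed
  have T_inj: "inj_on T (EV R)"
    unfolding T_def comp_assoc
  proof (intro comp_inj_on)
    show "inj_on (ev_lift Q) (EV R)" by (rule inj_on_ev_lift[OF QR])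
    show "inj_on \<epsilon> (ev_lift Q ` EV R)"
      using inj by (rule inj_on_subset) (use ev_lift_in_EV QR in auto)
    show "inj_on (ev_drop Q) ((\<epsilon> \<circ> ev_lift Q) ` EV R)"
      using inj_on_ev_drop by (rule inj_on_subset) (use Y in fastforce)
  qed
  have hom: "induced_map P T \<xi> \<in> Hom P S" if "\<xi> \<in> Hom P R" for P :: "'p rel" and \<xi>
    using induced_map_in_Hom[OF T_hom _ that] assms(4) by (simp add: fin_poset_def order_on_defs)
  have al: "alpha P (induced_map P T \<xi>) x = T (alpha P \<xi> x)"
    if P: "P \<in> Pr" and xi: "\<xi> \<in> Hom P R" and x: "x \<in> Field P" for P \<xi> x
  proof -
    have "fin_poset P" using P assms(1) by (simp add: rep_system_def)
    then obtain W i j where W: "W \<in> Pr" and "ord_sum_copy Q P W i j"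
      using rep_system_ord_sum_copy[OF assms(1,2)] by metis
    then interpret ord_sum_copy Q P W i j by simp
    let ?\<tau> = "induced_map P T \<xi>"
    \<comment> \<open>The glued map is the identity on the copy of \<open>Q\<close> and
      \<open>\<xi>\<close> on the copy of \<open>P\<close>, read through the inverses of
      \<open>i\<close> and \<open>j\<close>.\<close>
    define \<xi>' where "\<xi>' = (\<lambda>z\<in>Field W. if z \<in> i ` Field Q then inv_into (Field Q) i z
      else \<xi> (inv_into (Field P) j z))"
    have xi'_i: "\<xi>' (i q) = q" if "q \<in> Field Q" for q
      using that inj_i by (simp add: \<xi>'_def Field_copy)
    have xi'_j: "\<xi>' (j z) = \<xi> z" if "z \<in> Field P" for z
      using that inj_j disjoint by (auto simp: \<xi>'_def Field_copy)
    have xi_R: "\<xi> z \<in> Field R" if "z \<in> Field P" for z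
      using xi that by (auto simp: Hom_def)
    have xi'_hom: "\<xi>' \<in> Hom W (Q \<oplus> R)"
    proof -
      have "(\<xi>' u, \<xi>' v) \<in> Q \<oplus> R" if "(u, v) \<in> W" for u v
      proof -
        have "u \<in> i ` Field Q \<union> j ` Field P" "v \<in> i ` Field Q \<union> j ` Field P"
          using that Field_copy by (auto dest: FieldI1 FieldI2)
        then show ?thesis
          using that xi xi_R ii jj ji by (auto simp: xi'_i xi'_j ord_sum_def Hom_def)
      qed
      moreover have "\<xi>' z \<in> Field (Q \<oplus> R)" if "z \<in> Field W" for z
        using that xi_R by (auto simp: xi'_i xi'_j Field_ord_sum Field_copy)
      moreover have "\<xi>' \<in> extensional (Field W)" by (simp add: \<xi>'_def)
      ultimately show ?thesis by (auto simp: Hom_def PiE_def)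
    qed
    have lift: "alpha W \<xi>' (j z) = ev_lift Q (alpha P \<xi> z)" if "z \<in> Field P" for z
    proof (rule alpha_copy)
      show "\<xi>' ` i ` Field Q = Field Q" by (force simp: xi'_i image_image)
      show "Field Q \<inter> \<xi> ` Field P = {}" using xi_R QR by auto
    qed (use xi'_j that in auto)
    let ?\<eta> = "induced_map W \<epsilon> \<xi>'"
    have eta_j: "?\<eta> (j z) = ?\<tau> z" if "z \<in> Field P" for z
      using that lift by (simp add: induced_map_def Field_copy T_def)
    have eta_S: "?\<tau> z \<in> Field S" if "z \<in> Field P" for z
      using hom[OF xi] that by (auto simp: Hom_def)
    have alW: "alpha W ?\<eta> (j x) = \<epsilon> (ev_lift Q (alpha P \<xi> x))"
      using assms(9) W xi'_hom x lift[OF x] by (simp add: Field_copy)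
    have "Field Q \<subseteq> ?\<eta> ` Field W"
    proof -
      have "down_open W (fibre_comp W ?\<eta> (j x)) \<subseteq> Field W"
        by (auto simp: down_open_def dest: FieldI1)
      \<comment> \<open>The lower set of \<open>alpha\<close> consists of values of
        \<open>?\<eta>\<close>, so every element of \<open>Field Q\<close> is attained.\<close>
      moreover have "Field Q \<subseteq> ?\<eta> ` down_open W (fibre_comp W ?\<eta> (j x))"
        using Y[OF alpha_in_EV[OF xi x]] unfolding alW[symmetric] by (simp add: alpha_def)
      ultimately show ?thesis by blast
    qed
    moreover have "?\<eta> ` j ` Field P \<subseteq> Field S" using eta_j eta_S by auto
    \<comment> \<open>Values on the copy of \<open>P\<close> lie in \<open>S\<close>, so elements of
      \<open>Field Q\<close> are attained only on the copy of \<open>Q\<close>.\<close>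
    ultimately have sub: "Field Q \<subseteq> ?\<eta> ` i ` Field Q"
      using QS unfolding Field_copy by blast
    have fin: "finite (Field Q)" using assms(2) by (simp add: fin_poset_def)
    \<comment> \<open>The image has at most \<open>card (Field Q)\<close> elements and contains
      \<open>Field Q\<close>, hence equals it.\<close>
    have "?\<eta> ` i ` Field Q = Field Q"
      using card_seteq[OF _ sub] fin by (simp add: image_image card_image_le)
    then have "alpha W ?\<eta> (j x) = ev_lift Q (alpha P ?\<tau> x)"
      using x eta_j eta_S QS by (intro alpha_copy) auto
    then have T_al: "T (alpha P \<xi> x) = ev_drop Q (ev_lift Q (alpha P ?\<tau> x))"
      using alW by (simp add: T_def)
    \<comment> \<open>Being inside \<open>S\<close>, this lower set meets no point of
      \<open>Q\<close>, so dropping undoes lifting.\<close>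
    have "fst (snd (alpha P ?\<tau> x)) \<subseteq> Field S"
      using alpha_in_EV[OF hom[OF xi] x] by (auto simp: EV_def down_open_def dest: FieldI1)
    then have "fst (snd (alpha P ?\<tau> x)) \<inter> Field Q = {}" using QS by blast
    then show ?thesis unfolding T_al by (rule ev_drop_lift[symmetric])
  qed
  have "I_below Pr R S" using T_hom T_inj hom al by (rule I_below_induced)
  then show ?thesis using T_hom T_inj hom al by (simp add: Let_def flip: T_def)
qed

end
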